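(* Let $\Lambda,\Sigma$ be connected $k$-graphs and let $p:\Sigma\to\Lambda$ be a covering. Then $i_\Lambda:\Lambda\to\Pi(\Lambda)$ is injective if and only if $i_\Sigma:\Sigma\to\Pi(\Sigma)$ is injective.
   Context: A $k$-graph is a small category $\Lambda$ (identified with its set of morphisms) with a functor $d:\Lambda\to\mathbb{N}^k$ satisfying the factorisation property: if $d(\lambda)=m+n$ there are unique $\mu,\nu\in\Lambda$ with $d(\mu)=m$, $d(\nu)=n$, $\lambda=\mu\nu$. $\Lambda^0=d^{-1}(0)$ is the set of identity morphisms (vertices); $r,s:\Lambda\to\Lambda^0$ are the codomain and domain maps; $u\Lambda=r^{-1}(u)$, $\Lambda v=s^{-1}(v)$, $u\Lambda v=u\Lambda\cap\Lambda v$. $\Lambda$ is connected if the equivalence relation on $\Lambda^0$ generated by $\{(u,v):u\Lambda v\ne\emptyset\}$ is all of $\Lambda^0\times\Lambda^0$. A covering $p:\Sigma\to\Lambda$ is a surjective degree-preserving functor such that for all $v\in\Sigma^0$, $p$ restricts to bijections $\Sigma v\to\Lambda p(v)$ and $v\Sigma\to p(v)\Lambda$. The fundamental groupoid of a $k$-graph $\Lambda$ is a groupoid $\Pi(\Lambda)$ with a functor $i=i_\Lambda:\Lambda\to\Pi(\Lambda)$, $i(\Lambda^0)=\Pi(\Lambda)^0$, such that every functor $F$ from $\Lambda$ to a groupoid $\mathcal G$ is $\tilde F\circ i$ for a unique groupoid homomorphism $\tilde F:\Pi(\Lambda)\to\mathcal G$. *)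

theory Defs
  imports "HOL-Library.FuncSet" "HOL-Library.Function_Algebras"
begin

section \<open>Small categories, functors and groupoids\<close>

text \<open>A small category is identified with its set of morphisms; its objects are the
  identity morphisms.  The product \<^term>\<open>cmp C x y\<close> is ``x after y'': it is meaningful when the
  domain \<^term>\<open>src C x\<close> equals the codomain \<^term>\<open>tgt C y\<close>.\<close>

record 'a cat =
  mor :: "'a set"
  src :: "'a \<Rightarrow> 'a"
  tgt :: "'a \<Rightarrow> 'a"
  cmp :: "'a \<Rightarrow> 'a \<Rightarrow> 'a" (infixl "\<odot>\<index>" 70)

locale category =
  fixes C :: "('a, 'm) cat_scheme" (structure)
  assumes src_mor [simp]: "x \<in> mor C \<Longrightarrow> src C x \<in> mor C"
    and tgt_mor [simp]: "x \<in> mor C \<Longrightarrow> tgt C x \<in> mor C"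
    and src_src [simp]: "x \<in> mor C \<Longrightarrow> src C (src C x) = src C x"
    and tgt_src [simp]: "x \<in> mor C \<Longrightarrow> tgt C (src C x) = src C x"
    and src_tgt [simp]: "x \<in> mor C \<Longrightarrow> src C (tgt C x) = tgt C x"
    and tgt_tgt [simp]: "x \<in> mor C \<Longrightarrow> tgt C (tgt C x) = tgt C x"
    and cmp_mor [simp]: "\<lbrakk>x \<in> mor C; y \<in> mor C; src C x = tgt C y\<rbrakk> \<Longrightarrow> x \<odot> y \<in> mor C"
    and src_cmp [simp]: "\<lbrakk>x \<in> mor C; y \<in> mor C; src C x = tgt C y\<rbrakk> \<Longrightarrow> src C (x \<odot> y) = src C y"
    and tgt_cmp [simp]: "\<lbrakk>x \<in> mor C; y \<in> mor C; src C x = tgt C y\<rbrakk> \<Longrightarrow> tgt C (x \<odot> y) = tgt C x"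
    and assoc: "\<lbrakk>x \<in> mor C; y \<in> mor C; z \<in> mor C; src C x = tgt C y; src C y = tgt C z\<rbrakk>
                 \<Longrightarrow> (x \<odot> y) \<odot> z = x \<odot> (y \<odot> z)"
    and tgt_unit [simp]: "x \<in> mor C \<Longrightarrow> tgt C x \<odot> x = x"
    and src_unit [simp]: "x \<in> mor C \<Longrightarrow> x \<odot> src C x = x"

definition obj :: "('a, 'm) cat_scheme \<Rightarrow> 'a set" where
  "obj C = {v \<in> mor C. src C v = v}"

definition is_functor ::
    "('a, 'm) cat_scheme \<Rightarrow> ('b, 'n) cat_scheme \<Rightarrow> ('a \<Rightarrow> 'b) \<Rightarrow> bool" where
  "is_functor C D F \<longleftrightarrow>
     (\<forall>x\<in>mor C. F x \<in> mor D \<and> F (src C x) = src D (F x) \<and> F (tgt C x) = tgt D (F x)) \<and>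
     (\<forall>x\<in>mor C. \<forall>y\<in>mor C. src C x = tgt C y \<longrightarrow> F (x \<odot>\<^bsub>C\<^esub> y) = F x \<odot>\<^bsub>D\<^esub> F y)"

locale groupoid = category +
  assumes inverse: "g \<in> mor C \<Longrightarrow>
    \<exists>h\<in>mor C. src C h = tgt C g \<and> tgt C h = src C g \<and> g \<odot> h = tgt C g \<and> h \<odot> g = src C g"


section \<open>Higher-rank graphs\<close>

text \<open>The monoid \<open>\<nat>\<^sup>k\<close> is realised as the functions vanishing off \<open>{0..<k}\<close>, with pointwise
  addition; in this way \<open>k\<close> is an ordinary natural number.\<close>

definition Nat_pow :: "nat \<Rightarrow> (nat \<Rightarrow> nat) set" where
  "Nat_pow k = {n. \<forall>i\<ge>k. n i = 0}"

record 'a kgraph = "'a cat" +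
  deg :: "'a \<Rightarrow> (nat \<Rightarrow> nat)"

locale k_graph = category \<Lambda> for k :: nat and \<Lambda> :: "('a, 'm) kgraph_scheme" (structure) +
  assumes deg_range: "x \<in> mor \<Lambda> \<Longrightarrow> deg \<Lambda> x \<in> Nat_pow k"
    and deg_obj: "v \<in> obj \<Lambda> \<Longrightarrow> deg \<Lambda> v = 0"
    and deg_cmp: "\<lbrakk>x \<in> mor \<Lambda>; y \<in> mor \<Lambda>; src \<Lambda> x = tgt \<Lambda> y\<rbrakk> \<Longrightarrow> deg \<Lambda> (x \<odot> y) = deg \<Lambda> x + deg \<Lambda> y"
    and factorisation: "\<lbrakk>x \<in> mor \<Lambda>; m \<in> Nat_pow k; n \<in> Nat_pow k; deg \<Lambda> x = m + n\<rbrakk> \<Longrightarrow>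
      \<exists>!(\<mu>, \<nu>). \<mu> \<in> mor \<Lambda> \<and> \<nu> \<in> mor \<Lambda> \<and> deg \<Lambda> \<mu> = m \<and> deg \<Lambda> \<nu> = n \<and> src \<Lambda> \<mu> = tgt \<Lambda> \<nu> \<and> x = \<mu> \<odot> \<nu>"

definition hom_set :: "('a, 'm) cat_scheme \<Rightarrow> 'a \<Rightarrow> 'a \<Rightarrow> 'a set" where
  "hom_set C u v = {x \<in> mor C. tgt C x = u \<and> src C x = v}"

definition connected_cat :: "('a, 'm) cat_scheme \<Rightarrow> bool" where
  "connected_cat C \<longleftrightarrow>
     \<Inter> {E. equiv (obj C) E \<and> {(u, v). u \<in> obj C \<and> v \<in> obj C \<and> hom_set C u v \<noteq> {}} \<subseteq> E}
       = obj C \<times> obj C"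

definition covering ::
    "('b, 'm) kgraph_scheme \<Rightarrow> ('a, 'n) kgraph_scheme \<Rightarrow> ('b \<Rightarrow> 'a) \<Rightarrow> bool" where
  "covering \<Sigma> \<Lambda> p \<longleftrightarrow>
     is_functor \<Sigma> \<Lambda> p \<and>
     (\<forall>x\<in>mor \<Sigma>. deg \<Lambda> (p x) = deg \<Sigma> x) \<and>
     p ` mor \<Sigma> = mor \<Lambda> \<and>
     (\<forall>v\<in>obj \<Sigma>.
        bij_betw p {x \<in> mor \<Sigma>. src \<Sigma> x = v} {y \<in> mor \<Lambda>. src \<Lambda> y = p v} \<and>
        bij_betw p {x \<in> mor \<Sigma>. tgt \<Sigma> x = v} {y \<in> mor \<Lambda>. tgt \<Lambda> y = p v})"

lemma (in k_graph) obj_eq_deg_0: "obj \<Lambda> = {x \<in> mor \<Lambda>. deg \<Lambda> x = 0}"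
proof -
  have "x = src \<Lambda> x" if x: "x \<in> mor \<Lambda>" "deg \<Lambda> x = 0" for x
  proof -
    have s: "src \<Lambda> x \<in> obj \<Lambda>" and t: "tgt \<Lambda> x \<in> obj \<Lambda>" using x by (auto simp: obj_def)
    have "\<exists>!(\<mu>, \<nu>). \<mu> \<in> mor \<Lambda> \<and> \<nu> \<in> mor \<Lambda> \<and> deg \<Lambda> \<mu> = 0 \<and> deg \<Lambda> \<nu> = 0 \<and>
            src \<Lambda> \<mu> = tgt \<Lambda> \<nu> \<and> x = \<mu> \<odot> \<nu>"
      by (rule factorisation) (use x in \<open>auto simp: Nat_pow_def\<close>)
    moreover have "case (x, src \<Lambda> x) of (\<mu>, \<nu>) \<Rightarrow> \<mu> \<in> mor \<Lambda> \<and> \<nu> \<in> mor \<Lambda> \<and> deg \<Lambda> \<mu> = 0 \<and>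
            deg \<Lambda> \<nu> = 0 \<and> src \<Lambda> \<mu> = tgt \<Lambda> \<nu> \<and> x = \<mu> \<odot> \<nu>"
      using x deg_obj[OF s] by simp
    moreover have "case (tgt \<Lambda> x, x) of (\<mu>, \<nu>) \<Rightarrow> \<mu> \<in> mor \<Lambda> \<and> \<nu> \<in> mor \<Lambda> \<and> deg \<Lambda> \<mu> = 0 \<and>
            deg \<Lambda> \<nu> = 0 \<and> src \<Lambda> \<mu> = tgt \<Lambda> \<nu> \<and> x = \<mu> \<odot> \<nu>"
      using x deg_obj[OF t] by simp
    ultimately have "(x, src \<Lambda> x) = (tgt \<Lambda> x, x)" by blast
    then show ?thesis by simp
  qed
  then show ?thesis using deg_obj by (auto simp: obj_def)
qed


section \<open>The fundamental groupoid\<close>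

text \<open>Functions are total, so uniqueness of the induced homomorphism is asserted among the
  functions that are \<^const>\<open>undefined\<close> off the morphisms of \<open>G\<close>.\<close>

definition factors_uniquely ::
    "('a, 'm) cat_scheme \<Rightarrow> ('g, 'n) cat_scheme \<Rightarrow> ('a \<Rightarrow> 'g) \<Rightarrow> ('h, 'o) cat_scheme \<Rightarrow> bool" where
  "factors_uniquely \<Lambda> G i H \<longleftrightarrow>
     (\<forall>F. is_functor \<Lambda> H F \<longrightarrow>
        (\<exists>!F'. F' \<in> extensional (mor G) \<and> is_functor G H F' \<and> (\<forall>x\<in>mor \<Lambda>. F' (i x) = F x)))"

text \<open>The universal property ranges over all groupoids, but a definition cannot quantify over
  types.  It suffices to test it on groupoids whose morphisms lie in the type of \<open>G\<close> itself or in
  the type \<open>('a \<times> bool) list set\<close>: the theorem \<open>fundamental_groupoid_universal\<close> below shows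
  that the property then holds for groupoids over every type, and
  \<open>fundamental_groupoid_exists\<close> that such a \<open>G\<close> exists for every category.\<close>

definition fundamental_groupoid ::
    "('a, 'm) cat_scheme \<Rightarrow> 'g cat \<Rightarrow> ('a \<Rightarrow> 'g) \<Rightarrow> bool" where
  "fundamental_groupoid \<Lambda> G i \<longleftrightarrow>
     groupoid G \<and> is_functor \<Lambda> G i \<and> i ` obj \<Lambda> = obj G \<and>
     (\<forall>H :: 'g cat. groupoid H \<longrightarrow> factors_uniquely \<Lambda> G i H) \<and>
     (\<forall>H :: ('a \<times> bool) list set cat. groupoid H \<longrightarrow> factors_uniquely \<Lambda> G i H)"


subsection \<open>Existence, and the universal property over all types\<close>

text \<open>Arrows of the free groupoid on \<open>C\<close> are represented by nonempty composable words in the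
  signed morphisms of \<open>C\<close>, where \<open>(x, False)\<close> stands for the formal inverse of \<open>x\<close>.\<close>

context category
begin

fun ltgt :: "'a \<times> bool \<Rightarrow> 'a" where "ltgt (x, b) = (if b then tgt C x else src C x)"
fun lsrc :: "'a \<times> bool \<Rightarrow> 'a" where "lsrc (x, b) = (if b then src C x else tgt C x)"

definition wtgt :: "('a \<times> bool) list \<Rightarrow> 'a" where "wtgt w = ltgt (hd w)"
definition wsrc :: "('a \<times> bool) list \<Rightarrow> 'a" where "wsrc w = lsrc (last w)"

fun word :: "('a \<times> bool) list \<Rightarrow> bool" where
  "word [] = False"
| "word [a] = (fst a \<in> mor C)"
| "word (a # b # w) = (fst a \<in> mor C \<and> lsrc a = ltgt b \<and> word (b # w))"

inductive weq :: "('a \<times> bool) list \<Rightarrow> ('a \<times> bool) list \<Rightarrow> bool" where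
  weq_refl: "word w \<Longrightarrow> weq w w"
| weq_sym: "weq v w \<Longrightarrow> weq w v"
| weq_trans: "weq u v \<Longrightarrow> weq v w \<Longrightarrow> weq u w"
| weq_cong: "weq u u' \<Longrightarrow> weq v v' \<Longrightarrow> wsrc u = wtgt v \<Longrightarrow> weq (u @ v) (u' @ v')"
| weq_cmp: "x \<in> mor C \<Longrightarrow> y \<in> mor C \<Longrightarrow> src C x = tgt C y \<Longrightarrow> weq [(x, True), (y, True)] [(x \<odot> y, True)]"
| weq_inv_r: "x \<in> mor C \<Longrightarrow> weq [(x, True), (x, False)] [(tgt C x, True)]"
| weq_inv_l: "x \<in> mor C \<Longrightarrow> weq [(x, False), (x, True)] [(src C x, True)]"
| weq_unit_l: "x \<in> mor C \<Longrightarrow> weq [(src C x, True), (x, False)] [(x, False)]"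
| weq_unit_r: "x \<in> mor C \<Longrightarrow> weq [(x, False), (tgt C x, True)] [(x, False)]"

definition cls :: "('a \<times> bool) list \<Rightarrow> ('a \<times> bool) list set" where "cls w = {v. weq w v}"

definition rep :: "('a \<times> bool) list set \<Rightarrow> ('a \<times> bool) list" where "rep A = (SOME w. w \<in> A)"

definition Pi_cat :: "('a \<times> bool) list set cat" where
  "Pi_cat = \<lparr>mor = cls ` Collect word,
             src = (\<lambda>A. cls [(wsrc (rep A), True)]),
             tgt = (\<lambda>A. cls [(wtgt (rep A), True)]),
             cmp = (\<lambda>A B. cls (rep A @ rep B))\<rparr>"

definition Pi_incl :: "'a \<Rightarrow> ('a \<times> bool) list set" where "Pi_incl x = cls [(x, True)]"

lemma word_ne: "word w \<Longrightarrow> w \<noteq> []" by auto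

lemma word_Cons: "w \<noteq> [] \<Longrightarrow> word (a # w) \<longleftrightarrow> fst a \<in> mor C \<and> lsrc a = wtgt w \<and> word w"
  by (cases w) (auto simp: wtgt_def)

lemma wtgt_append [simp]: "u \<noteq> [] \<Longrightarrow> wtgt (u @ v) = wtgt u" by (simp add: wtgt_def)
lemma wsrc_append [simp]: "v \<noteq> [] \<Longrightarrow> wsrc (u @ v) = wsrc v" by (simp add: wsrc_def)
lemma wtgt_Cons [simp]: "wtgt (a # v) = ltgt a" by (simp add: wtgt_def)
lemma wsrc_sing [simp]: "wsrc [a] = lsrc a" by (simp add: wsrc_def)
lemma wsrc_Cons: "v \<noteq> [] \<Longrightarrow> wsrc (a # v) = wsrc v" by (simp add: wsrc_def)

lemma word_append: "u \<noteq> [] \<Longrightarrow> v \<noteq> [] \<Longrightarrow> word (u @ v) \<longleftrightarrow> word u \<and> word v \<and> wsrc u = wtgt v"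
proof (induction u)
  case (Cons a u)
  then show ?case by (cases "u = []") (auto simp: word_Cons wsrc_Cons)
qed simp

lemma weq_word: "weq u v \<Longrightarrow> word u \<and> word v \<and> wtgt u = wtgt v \<and> wsrc u = wsrc v"
proof (induction rule: weq.induct)
  case (weq_cong u u' v v')
  then have "u \<noteq> []" "u' \<noteq> []" "v \<noteq> []" "v' \<noteq> []" using word_ne by blast+
  then show ?case using weq_cong by (simp add: word_append)
qed (auto simp: wsrc_def)

lemma letter_mor: "fst a \<in> mor C \<Longrightarrow> ltgt a \<in> obj C \<and> lsrc a \<in> obj C"
  by (cases a) (auto simp: obj_def)

lemma word_ends: "word w \<Longrightarrow> wtgt w \<in> obj C \<and> wsrc w \<in> obj C"
proof (induction w rule: word.induct)
  case (3 a b w)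
  then show ?case using letter_mor[of a] by (simp add: wsrc_Cons)
qed (use letter_mor in auto)

lemma obj_mor: "v \<in> obj C \<Longrightarrow> v \<in> mor C \<and> src C v = v \<and> tgt C v = v"
  by (metis (mono_tags, lifting) mem_Collect_eq obj_def tgt_src)

lemma weq_unit_tgt: "word w \<Longrightarrow> weq ((wtgt w, True) # w) w"
proof -
  assume w: "word w"
  then obtain x b v where v: "w = (x, b) # v" by (cases w) auto
  have x: "x \<in> mor C" using w v by (cases v) auto
  have 1: "weq [(wtgt w, True), (x, b)] [(x, b)]"
    using v x weq_cmp[of "tgt C x" x] weq_unit_l[of x] by (cases b) auto
  show ?thesis
  proof (cases "v = []")
    case False
    then have "word v" "lsrc (x, b) = wtgt v" using w v by (auto simp: word_Cons)
    then have "weq ([(wtgt w, True), (x, b)] @ v) ([(x, b)] @ v)"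
      by (intro weq_cong 1 weq_refl) (simp_all add: wsrc_def)
    then show ?thesis using v by simp
  qed (use 1 v in simp)
qed

lemma weq_unit_src: "word w \<Longrightarrow> weq (w @ [(wsrc w, True)]) w"
proof -
  assume w: "word w"
  then have ne: "w \<noteq> []" by (rule word_ne)
  then obtain x b v where v: "w = v @ [(x, b)]" by (metis rev_exhaust surj_pair)
  have x: "x \<in> mor C" using w v by (cases "v = []") (auto simp: word_append)
  have 1: "weq [(x, b), (wsrc w, True)] [(x, b)]"
    using v x weq_cmp[of x "src C x"] weq_unit_r[of x] by (cases b) auto
  show ?thesis
  proof (cases "v = []")
    case False
    then have "word v" "wsrc v = ltgt (x, b)" using w v by (auto simp: word_append)
    then have "weq (v @ [(x, b), (wsrc w, True)]) (v @ [(x, b)])"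
      by (intro weq_cong 1 weq_refl) simp_all
    then show ?thesis using v by simp
  qed (use 1 v in simp)
qed

definition winv :: "('a \<times> bool) list \<Rightarrow> ('a \<times> bool) list" where
  "winv w = rev (map (\<lambda>(x, b). (x, \<not> b)) w)"

lemma winv_Cons: "winv (a # w) = winv w @ winv [a]" by (simp add: winv_def)
lemma winv_ne [simp]: "winv w = [] \<longleftrightarrow> w = []" by (simp add: winv_def)

lemma winv_word: "word w \<Longrightarrow> word (winv w) \<and> wtgt (winv w) = wsrc w \<and> wsrc (winv w) = wtgt w"
proof (induction w rule: word.induct)
  case (2 a)
  then show ?case by (cases a) (auto simp: winv_def)
next
  case (3 a b w)
  then have IH: "word (winv (b # w))" "wtgt (winv (b # w)) = wsrc (b # w)"
    "wsrc (winv (b # w)) = wtgt (b # w)" by auto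
  obtain x s where xs: "a = (x, s)" by fastforce
  have a: "word (winv [a])" "wtgt (winv [a]) = lsrc a" "wsrc (winv [a]) = ltgt a"
    using 3 xs by (auto simp: winv_def)
  show ?case
    unfolding winv_Cons[of a "b # w"] using IH a 3 by (simp add: word_append wsrc_Cons)
qed auto

lemma winv_winv: "winv (winv w) = w"
  by (simp add: winv_def rev_map comp_def case_prod_unfold)

lemma weq_winv: "word w \<Longrightarrow> weq (w @ winv w) [(wtgt w, True)]"
proof (induction w rule: word.induct)
  case (2 a)
  then show ?case using weq_inv_r weq_inv_l by (cases a) (auto simp: winv_def)
next
  case (3 a b w)
  let ?v = "b # w" and ?a = "[a]"
  have v: "word ?v" "lsrc a = wtgt ?v" and aw: "word ?a" using 3 by auto
  obtain x s where xs: "a = (x, s)" by fastforce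
  have a: "word (winv [a])" "wtgt (winv [a]) = lsrc a" "weq (?a @ winv ?a) [(ltgt a, True)]"
    using 3 xs weq_inv_r weq_inv_l by (auto simp: winv_def)
  have 0: "weq (?v @ winv ?v) [(lsrc a, True)]" using 3 v by simp
  have o: "lsrc a \<in> obj C" using letter_mor aw by simp
  have "weq ((?v @ winv ?v) @ winv ?a) ([(lsrc a, True)] @ winv ?a)"
    by (rule weq_cong[OF 0 weq_refl[OF a(1)]]) (use weq_word[OF 0] a obj_mor[OF o] in simp)
  moreover have "weq ([(lsrc a, True)] @ winv ?a) (winv ?a)"
    using weq_unit_tgt[OF a(1)] a by simp
  ultimately have 1: "weq ((?v @ winv ?v) @ winv ?a) (winv ?a)" by (rule weq_trans)
  have "weq (?a @ ((?v @ winv ?v) @ winv ?a)) (?a @ winv ?a)"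
    by (rule weq_cong[OF weq_refl[OF aw] 1]) (use v in simp)
  from weq_trans[OF this a(3)] show ?case unfolding winv_Cons[of a "b # w"] by simp
qed auto

lemma cls_eq: "word u \<Longrightarrow> cls u = cls v \<longleftrightarrow> weq u v"
  unfolding cls_def using weq_refl weq_sym weq_trans by blast

lemma weq_cls: "weq u v \<Longrightarrow> cls u = cls v"
  using weq_word cls_eq by blast

lemma weq_rep: "word w \<Longrightarrow> weq w (rep (cls w))"
  unfolding rep_def cls_def using someI[of "weq w" w] weq_refl by simp

lemma cls_rep: "word w \<Longrightarrow> cls (rep (cls w)) = cls w"
  using weq_rep cls_eq by metis

lemma word_unit [simp]: "word w \<Longrightarrow> word [(wsrc w, True)]" "word w \<Longrightarrow> word [(wtgt w, True)]"
  using word_ends obj_mor by auto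

lemma Pi_mor: "A \<in> mor Pi_cat \<longleftrightarrow> (\<exists>w. word w \<and> A = cls w)"
  by (auto simp: Pi_cat_def)

lemma cls_mor: "word w \<Longrightarrow> cls w \<in> mor Pi_cat"
  by (auto simp: Pi_mor)

lemma Pi_src: "word w \<Longrightarrow> src Pi_cat (cls w) = cls [(wsrc w, True)]"
  using weq_word[OF weq_rep] by (simp add: Pi_cat_def)

lemma Pi_tgt: "word w \<Longrightarrow> tgt Pi_cat (cls w) = cls [(wtgt w, True)]"
  using weq_word[OF weq_rep] by (simp add: Pi_cat_def)

lemma Pi_cmp: "word u \<Longrightarrow> word v \<Longrightarrow> wsrc u = wtgt v \<Longrightarrow> cls u \<odot>\<^bsub>Pi_cat\<^esub> cls v = cls (u @ v)"
  using weq_cls[OF weq_cong[OF weq_rep weq_rep, of u v]] by (simp add: Pi_cat_def)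

lemma unit_cls_eq: "u \<in> obj C \<Longrightarrow> v \<in> obj C \<Longrightarrow> cls [(u, True)] = cls [(v, True)] \<longleftrightarrow> u = v"
proof -
  assume u: "u \<in> obj C" and v: "v \<in> obj C"
  have "word [(u, True)]" using obj_mor[OF u] by simp
  then have "cls [(u, True)] = cls [(v, True)] \<longleftrightarrow> weq [(u, True)] [(v, True)]" by (rule cls_eq)
  then show ?thesis
    using weq_word[of "[(u, True)]" "[(v, True)]"] obj_mor[OF u] obj_mor[OF v] by auto
qed

lemma Pi_composable:
  "word u \<Longrightarrow> word v \<Longrightarrow> src Pi_cat (cls u) = tgt Pi_cat (cls v) \<longleftrightarrow> wsrc u = wtgt v"
  by (simp add: Pi_src Pi_tgt unit_cls_eq word_ends)

lemma wends_unit [simp]: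
  "word w \<Longrightarrow> src C (wsrc w) = wsrc w" "word w \<Longrightarrow> tgt C (wsrc w) = wsrc w"
  "word w \<Longrightarrow> src C (wtgt w) = wtgt w" "word w \<Longrightarrow> tgt C (wtgt w) = wtgt w"
  using word_ends obj_mor by auto

lemma word_app: "word u \<Longrightarrow> word v \<Longrightarrow> wsrc u = wtgt v \<Longrightarrow> word (u @ v)"
  using word_append word_ne by blast

lemma wends_app [simp]: "word u \<Longrightarrow> wtgt (u @ v) = wtgt u" "word v \<Longrightarrow> wsrc (u @ v) = wsrc v"
  using word_ne by auto

lemma Pi_groupoid: "groupoid Pi_cat"
proof unfold_locales
  fix A assume A: "A \<in> mor Pi_cat"
  then obtain w where w: "word w" "A = cls w" by (auto simp: Pi_mor)
  note u = word_unit[OF w(1)]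
  show "src Pi_cat A \<in> mor Pi_cat" "tgt Pi_cat A \<in> mor Pi_cat"
    using w u by (simp_all add: Pi_src Pi_tgt cls_mor del: word.simps)
  show "src Pi_cat (src Pi_cat A) = src Pi_cat A" "tgt Pi_cat (src Pi_cat A) = src Pi_cat A"
    "src Pi_cat (tgt Pi_cat A) = tgt Pi_cat A" "tgt Pi_cat (tgt Pi_cat A) = tgt Pi_cat A"
    using w u by (simp_all add: Pi_src Pi_tgt del: word.simps)
  show "tgt Pi_cat A \<odot>\<^bsub>Pi_cat\<^esub> A = A"
  proof -
    have "cls [(wtgt w, True)] \<odot>\<^bsub>Pi_cat\<^esub> cls w = cls ([(wtgt w, True)] @ w)"
      by (rule Pi_cmp) (use w u in \<open>simp_all del: word.simps\<close>)
    also have "\<dots> = cls w" using weq_cls[OF weq_unit_tgt[OF w(1)]] by simp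
    finally show ?thesis using w by (simp add: Pi_tgt)
  qed
  show "A \<odot>\<^bsub>Pi_cat\<^esub> src Pi_cat A = A"
  proof -
    have "cls w \<odot>\<^bsub>Pi_cat\<^esub> cls [(wsrc w, True)] = cls (w @ [(wsrc w, True)])"
      by (rule Pi_cmp) (use w u in \<open>simp_all del: word.simps\<close>)
    also have "\<dots> = cls w" using weq_cls[OF weq_unit_src[OF w(1)]] by simp
    finally show ?thesis using w by (simp add: Pi_src)
  qed
  show "\<exists>h\<in>mor Pi_cat. src Pi_cat h = tgt Pi_cat A \<and> tgt Pi_cat h = src Pi_cat A \<and>
          A \<odot>\<^bsub>Pi_cat\<^esub> h = tgt Pi_cat A \<and> h \<odot>\<^bsub>Pi_cat\<^esub> A = src Pi_cat A"
  proof (intro bexI[of _ "cls (winv w)"] conjI)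
    note i = winv_word[OF w(1)]
    show "cls (winv w) \<in> mor Pi_cat" using i by (auto simp: Pi_mor)
    show "src Pi_cat (cls (winv w)) = tgt Pi_cat A" "tgt Pi_cat (cls (winv w)) = src Pi_cat A"
      using i w by (simp_all add: Pi_src Pi_tgt)
    have "cls (w @ winv w) = cls [(wtgt w, True)]"
      using weq_cls[OF weq_winv[OF w(1)]] by simp
    then show "A \<odot>\<^bsub>Pi_cat\<^esub> cls (winv w) = tgt Pi_cat A" using i w by (simp add: Pi_cmp Pi_tgt)
    have "cls (winv w @ w) = cls [(wsrc w, True)]"
      using weq_cls[OF weq_winv[of "winv w"]] i by (simp add: winv_winv)
    then show "cls (winv w) \<odot>\<^bsub>Pi_cat\<^esub> A = src Pi_cat A" using i w by (simp add: Pi_cmp Pi_src)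
  qed
next
  fix A B assume "A \<in> mor Pi_cat" "B \<in> mor Pi_cat" and AB: "src Pi_cat A = tgt Pi_cat B"
  then obtain u v where u: "word u" "A = cls u" and v: "word v" "B = cls v"
    by (auto simp: Pi_mor)
  have uv: "wsrc u = wtgt v" using AB u v Pi_composable by simp
  have w: "word (u @ v)" using word_app u v uv by simp
  show "A \<odot>\<^bsub>Pi_cat\<^esub> B \<in> mor Pi_cat" using u v uv w by (auto simp: Pi_cmp Pi_mor)
  show "src Pi_cat (A \<odot>\<^bsub>Pi_cat\<^esub> B) = src Pi_cat B" "tgt Pi_cat (A \<odot>\<^bsub>Pi_cat\<^esub> B) = tgt Pi_cat A"
    using u v uv w by (simp_all add: Pi_cmp Pi_src Pi_tgt)
  fix D assume "D \<in> mor Pi_cat" and BD: "src Pi_cat B = tgt Pi_cat D"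
  then obtain t where t: "word t" "D = cls t" by (auto simp: Pi_mor)
  have vt: "wsrc v = wtgt t" using BD t v Pi_composable by simp
  have w': "word (v @ t)" using word_app t v vt by simp
  show "A \<odot>\<^bsub>Pi_cat\<^esub> B \<odot>\<^bsub>Pi_cat\<^esub> D = A \<odot>\<^bsub>Pi_cat\<^esub> (B \<odot>\<^bsub>Pi_cat\<^esub> D)"
    using u v t uv vt w w' by (simp add: Pi_cmp)
qed

lemma Pi_incl_functor: "is_functor C Pi_cat Pi_incl"
  unfolding is_functor_def Pi_incl_def
proof (intro ballI conjI impI)
  fix x assume x: "x \<in> mor C"
  then have w: "word [(x, True)]" by simp
  show "cls [(x, True)] \<in> mor Pi_cat" using w Pi_mor by blast
  show "cls [(src C x, True)] = src Pi_cat (cls [(x, True)])" using Pi_src[OF w] by simp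
  show "cls [(tgt C x, True)] = tgt Pi_cat (cls [(x, True)])" using Pi_tgt[OF w] by simp
  fix y assume y: "y \<in> mor C" "src C x = tgt C y"
  have "cls ([(x, True)] @ [(y, True)]) = cls [(x \<odot> y, True)]"
    using weq_cls[OF weq_cmp[OF x y]] by simp
  then show "cls [(x \<odot> y, True)] = cls [(x, True)] \<odot>\<^bsub>Pi_cat\<^esub> cls [(y, True)]"
    using Pi_cmp[of "[(x, True)]" "[(y, True)]"] x y by simp
qed

lemma Pi_incl_obj: "Pi_incl ` obj C = obj Pi_cat"
proof -
  have "cls [(v, True)] \<in> obj Pi_cat" if "v \<in> obj C" for v
    using Pi_src[of "[(v, True)]"] cls_mor[of "[(v, True)]"] obj_mor[OF that] by (auto simp: obj_def)
  moreover have "A \<in> Pi_incl ` obj C" if A: "A \<in> obj Pi_cat" for A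
  proof -
    obtain w where w: "word w" "A = cls w" and s: "src Pi_cat A = A"
      using A by (auto simp: obj_def Pi_mor)
    then show ?thesis using Pi_src[OF w(1)] word_ends by (auto simp: Pi_incl_def)
  qed
  ultimately show ?thesis by (auto simp: Pi_incl_def)
qed

end

definition (in groupoid) ginv :: "'a \<Rightarrow> 'a" where
  "ginv g = (SOME h. h \<in> mor C \<and> src C h = tgt C g \<and> tgt C h = src C g \<and>
                     g \<odot> h = tgt C g \<and> h \<odot> g = src C g)"

context groupoid
begin

lemma ginv:
  assumes "g \<in> mor C"
  shows "ginv g \<in> mor C" "src C (ginv g) = tgt C g" "tgt C (ginv g) = src C g"
    "g \<odot> ginv g = tgt C g" "ginv g \<odot> g = src C g"
proof -
  have "\<exists>h. h \<in> mor C \<and> src C h = tgt C g \<and> tgt C h = src C g \<and> g \<odot> h = tgt C g \<and> h \<odot> g = src C g"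
    using inverse[OF assms] by blast
  from someI_ex[OF this]
  show "ginv g \<in> mor C" "src C (ginv g) = tgt C g" "tgt C (ginv g) = src C g"
    "g \<odot> ginv g = tgt C g" "ginv g \<odot> g = src C g"
    unfolding ginv_def by blast+
qed

lemma ginv_unique:
  assumes "g \<in> mor C" "h \<in> mor C" "src C h = tgt C g" "tgt C h = src C g" "g \<odot> h = tgt C g"
  shows "h = ginv g"
proof -
  have "h = (ginv g \<odot> g) \<odot> h" using assms ginv[OF assms(1)] tgt_unit[of h] by simp
  also have "\<dots> = ginv g \<odot> (g \<odot> h)" by (rule assoc) (use assms ginv[OF assms(1)] in auto)
  also have "\<dots> = ginv g \<odot> tgt C g" using assms by simp
  also have "\<dots> = ginv g" using assms ginv[OF assms(1)] src_unit[of "ginv g"] by simp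
  finally show ?thesis .
qed

end

locale functor_to_groupoid = category C + H: groupoid H
  for C :: "('a, 'm) cat_scheme" (structure) and H :: "('h, 'n) cat_scheme" +
  fixes F :: "'a \<Rightarrow> 'h"
  assumes F: "is_functor C H F"
begin

lemma F_simps [simp]:
  "x \<in> mor C \<Longrightarrow> F x \<in> mor H"
  "x \<in> mor C \<Longrightarrow> F (src C x) = src H (F x)"
  "x \<in> mor C \<Longrightarrow> F (tgt C x) = tgt H (F x)"
  "\<lbrakk>x \<in> mor C; y \<in> mor C; src C x = tgt C y\<rbrakk> \<Longrightarrow> F (x \<odot> y) = F x \<odot>\<^bsub>H\<^esub> F y"
  using F by (auto simp: is_functor_def)

lemma F_composable: "x \<in> mor C \<Longrightarrow> y \<in> mor C \<Longrightarrow> src C x = tgt C y \<Longrightarrow> src H (F x) = tgt H (F y)"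
  using F_simps(2)[of x] F_simps(3)[of y] by simp

fun lev :: "'a \<times> bool \<Rightarrow> 'h" where "lev (x, b) = (if b then F x else H.ginv (F x))"

fun ev :: "('a \<times> bool) list \<Rightarrow> 'h" where
  "ev [] = undefined"
| "ev [a] = lev a"
| "ev (a # b # w) = lev a \<odot>\<^bsub>H\<^esub> ev (b # w)"

lemma lev: "fst a \<in> mor C \<Longrightarrow> lev a \<in> mor H \<and> src H (lev a) = F (lsrc a) \<and> tgt H (lev a) = F (ltgt a)"
  by (cases a) (auto simp: H.ginv)

lemma ev: "word w \<Longrightarrow> ev w \<in> mor H \<and> src H (ev w) = F (wsrc w) \<and> tgt H (ev w) = F (wtgt w)"
proof (induction w rule: word.induct)
  case (3 a b w)
  then show ?case using lev[of a] by (simp add: wsrc_Cons)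
qed (use lev in auto)

lemma ev_append: "word u \<Longrightarrow> word v \<Longrightarrow> wsrc u = wtgt v \<Longrightarrow> ev (u @ v) = ev u \<odot>\<^bsub>H\<^esub> ev v"
proof (induction u rule: word.induct)
  case (2 a)
  then show ?case by (cases v) auto
next
  case (3 a b w)
  then have IH: "ev ((b # w) @ v) = ev (b # w) \<odot>\<^bsub>H\<^esub> ev v" by (simp add: wsrc_Cons)
  have "src H (lev a) = tgt H (ev (b # w))" "src H (ev (b # w)) = tgt H (ev v)"
    using 3 lev[of a] ev[of "b # w"] ev[of v] by (simp_all add: wsrc_Cons)
  then show ?case using IH 3 lev[of a] ev[of "b # w"] ev[of v] by (simp add: H.assoc)
qed simp

lemma ev_weq: "weq u v \<Longrightarrow> ev u = ev v"
proof (induction rule: weq.induct)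
  case (weq_cong u u' v v')
  then show ?case using weq_word[of u u'] weq_word[of v v'] by (simp add: ev_append)
next
  case (weq_unit_l x)
  then show ?case using H.ginv[of "F x"] H.tgt_unit[of "H.ginv (F x)"] by simp
next
  case (weq_unit_r x)
  then show ?case using H.ginv[of "F x"] H.src_unit[of "H.ginv (F x)"] by simp
qed (auto simp: H.ginv)

definition Pi_lift :: "('a \<times> bool) list set \<Rightarrow> 'h" where
  "Pi_lift = restrict (\<lambda>A. ev (rep A)) (mor Pi_cat)"

lemma Pi_lift: "word w \<Longrightarrow> Pi_lift (cls w) = ev w"
  using ev_weq[OF weq_rep] by (auto simp: Pi_lift_def Pi_mor)

lemma Pi_lift_functor: "is_functor Pi_cat H Pi_lift"
  unfolding is_functor_def
proof (intro ballI conjI impI)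
  fix A assume "A \<in> mor Pi_cat"
  then obtain u where u: "word u" "A = cls u" by (auto simp: Pi_mor)
  show "Pi_lift A \<in> mor H" using ev u by (simp add: Pi_lift)
  show "Pi_lift (src Pi_cat A) = src H (Pi_lift A)" "Pi_lift (tgt Pi_cat A) = tgt H (Pi_lift A)"
    using u ev[OF u(1)] word_unit[OF u(1)] by (simp_all add: Pi_lift Pi_src Pi_tgt del: word.simps)
  fix B assume "B \<in> mor Pi_cat" and AB: "src Pi_cat A = tgt Pi_cat B"
  then obtain v where v: "word v" "B = cls v" by (auto simp: Pi_mor)
  have uv: "wsrc u = wtgt v" using AB u v Pi_composable by simp
  show "Pi_lift (A \<odot>\<^bsub>Pi_cat\<^esub> B) = Pi_lift A \<odot>\<^bsub>H\<^esub> Pi_lift B"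
    using u v uv by (simp add: Pi_cmp Pi_lift word_app ev_append)
qed

lemma Pi_lift_incl: "x \<in> mor C \<Longrightarrow> Pi_lift (Pi_incl x) = F x"
  by (simp add: Pi_incl_def Pi_lift)

lemma Pi_lift_unique:
  assumes K: "is_functor Pi_cat H K" and KF: "\<And>x. x \<in> mor C \<Longrightarrow> K (Pi_incl x) = F x"
    and A: "A \<in> mor Pi_cat"
  shows "K A = Pi_lift A"
proof -
  have P: "groupoid Pi_cat" by (rule Pi_groupoid)
  have K1: "K A \<in> mor H" "K (src Pi_cat A) = src H (K A)" "K (tgt Pi_cat A) = tgt H (K A)"
    if "A \<in> mor Pi_cat" for A using K that by (auto simp: is_functor_def)
  have K2: "K (cls (u @ v)) = K (cls u) \<odot>\<^bsub>H\<^esub> K (cls v)"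
    if "word u" "word v" "wsrc u = wtgt v" for u v
  proof -
    have "cls u \<in> mor Pi_cat" "cls v \<in> mor Pi_cat" "src Pi_cat (cls u) = tgt Pi_cat (cls v)"
      using that by (auto simp: cls_mor Pi_composable)
    then show ?thesis using K that Pi_cmp[of u v] unfolding is_functor_def by metis
  qed
  have KT: "K (cls [(x, True)]) = F x" if "x \<in> mor C" for x
    using KF[OF that] by (simp add: Pi_incl_def)
  have L: "K (cls [a]) = lev a" if a: "fst a \<in> mor C" for a
  proof -
    obtain x b where ab: "a = (x, b)" by fastforce
    have x: "x \<in> mor C" using a ab by simp
    have "K (cls [(x, False)]) = H.ginv (F x)"
    proof (rule H.ginv_unique)
      have m: "cls [(x, False)] \<in> mor Pi_cat" using x cls_mor by simp
      have e: "src Pi_cat (cls [(x, False)]) = cls [(tgt C x, True)]"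
        "tgt Pi_cat (cls [(x, False)]) = cls [(src C x, True)]"
        using Pi_src[of "[(x, False)]"] Pi_tgt[of "[(x, False)]"] x by simp_all
      show "F x \<in> mor H" "K (cls [(x, False)]) \<in> mor H" using x K1 m by auto
      show "src H (K (cls [(x, False)])) = tgt H (F x)" "tgt H (K (cls [(x, False)])) = src H (F x)"
        using K1(2)[OF m] K1(3)[OF m] e x KT by simp_all
      have "cls ([(x, True)] @ [(x, False)]) = cls [(tgt C x, True)]"
        using weq_cls[OF weq_inv_r[OF x]] by simp
      then show "F x \<odot>\<^bsub>H\<^esub> K (cls [(x, False)]) = tgt H (F x)"
        using K2[of "[(x, True)]" "[(x, False)]"] x KT by simp
    qed
    then show ?thesis using KT x ab by simp
  qed
  have "K (cls w) = ev w" if "word w" for w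
    using that
  proof (induction w rule: word.induct)
    case (3 a b w)
    then show ?case using K2[of "[a]" "b # w"] L by simp
  qed (use L in auto)
  then show ?thesis using A by (auto simp: Pi_mor Pi_lift)
qed

end

lemma Pi_factors_uniquely:
  assumes "category C" "groupoid H"
  shows "factors_uniquely C (category.Pi_cat C) (category.Pi_incl C) H"
  unfolding factors_uniquely_def
proof (intro allI impI)
  fix F assume F: "is_functor C H F"
  interpret functor_to_groupoid C H F
    using assms F by (simp add: functor_to_groupoid_def functor_to_groupoid_axioms_def)
  show "\<exists>!F'. F' \<in> extensional (mor Pi_cat) \<and> is_functor Pi_cat H F' \<and>
              (\<forall>x\<in>mor C. F' (Pi_incl x) = F x)"
  proof (rule ex1I[of _ Pi_lift])
    show "Pi_lift \<in> extensional (mor Pi_cat) \<and> is_functor Pi_cat H Pi_lift \<and>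
          (\<forall>x\<in>mor C. Pi_lift (Pi_incl x) = F x)"
      using Pi_lift_functor Pi_lift_incl by (simp add: Pi_lift_def)
    fix K assume K: "K \<in> extensional (mor Pi_cat) \<and> is_functor Pi_cat H K \<and>
          (\<forall>x\<in>mor C. K (Pi_incl x) = F x)"
    show "K = Pi_lift"
      by (rule extensionalityI[of _ "mor Pi_cat"]) (use K Pi_lift_unique in \<open>auto simp: Pi_lift_def\<close>)
  qed
qed

theorem fundamental_groupoid_exists:
  assumes "category C"
  shows "fundamental_groupoid C (category.Pi_cat C) (category.Pi_incl C)"
  unfolding fundamental_groupoid_def
  using category.Pi_groupoid[OF assms] category.Pi_incl_functor[OF assms]
    category.Pi_incl_obj[OF assms] Pi_factors_uniquely[OF assms] by blast

lemma is_functor_comp: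
  assumes "is_functor A B F" "is_functor B C K"
  shows "is_functor A C (K \<circ> F)"
  unfolding is_functor_def
proof (intro ballI conjI impI)
  fix x assume x: "x \<in> mor A"
  show "(K \<circ> F) x \<in> mor C" "(K \<circ> F) (src A x) = src C ((K \<circ> F) x)"
    "(K \<circ> F) (tgt A x) = tgt C ((K \<circ> F) x)"
    using assms x by (auto simp: is_functor_def)
  fix y assume y: "y \<in> mor A" and xy: "src A x = tgt A y"
  have "src B (F x) = tgt B (F y)" using assms(1) x y xy by (metis is_functor_def)
  then show "(K \<circ> F) (x \<odot>\<^bsub>A\<^esub> y) = (K \<circ> F) x \<odot>\<^bsub>C\<^esub> (K \<circ> F) y"
    using assms x y xy by (auto simp: is_functor_def)
qed

lemma is_functor_cong:
  assumes "is_functor A B F" "category A" "\<And>x. x \<in> mor A \<Longrightarrow> F x = K x"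
  shows "is_functor A B K"
  using assms(1) assms(3)[symmetric] category.cmp_mor[OF assms(2)] category.src_mor[OF assms(2)]
    category.tgt_mor[OF assms(2)]
  by (simp add: is_functor_def)

lemma factors_uniquely_exists:
  assumes "factors_uniquely \<Lambda> G i H" "is_functor \<Lambda> H F"
  obtains F' where "is_functor G H F'" "\<And>x. x \<in> mor \<Lambda> \<Longrightarrow> F' (i x) = F x"
  using assms unfolding factors_uniquely_def by blast

lemma factors_uniquely_eq:
  assumes u: "factors_uniquely \<Lambda> G i H" and G: "category G" and i: "is_functor \<Lambda> G i"
    and K: "is_functor G H K" and L: "is_functor G H L"
    and eq: "\<And>x. x \<in> mor \<Lambda> \<Longrightarrow> K (i x) = L (i x)" and g: "g \<in> mor G"
  shows "K g = L g"
proof -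
  let ?P = "\<lambda>F'. F' \<in> extensional (mor G) \<and> is_functor G H F' \<and> (\<forall>x\<in>mor \<Lambda>. F' (i x) = (K \<circ> i) x)"
  have im: "i x \<in> mor G" if "x \<in> mor \<Lambda>" for x using i that by (simp add: is_functor_def)
  have "?P (restrict K (mor G))" using K G im by (auto intro: is_functor_cong)
  moreover have "?P (restrict L (mor G))" using L G im eq by (auto intro: is_functor_cong)
  moreover have "\<exists>!F'. ?P F'"
    using u is_functor_comp[OF i K] unfolding factors_uniquely_def by blast
  ultimately have "restrict K (mor G) = restrict L (mor G)" by blast
  then show ?thesis using g by (metis restrict_apply')
qed

theorem fundamental_groupoid_universal:
  fixes \<Lambda> :: "('a, 'm) cat_scheme" and G :: "'g cat" and H :: "('h, 'o) cat_scheme"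
  assumes cat: "category \<Lambda>" and fg: "fundamental_groupoid \<Lambda> G i" and H: "groupoid H"
  shows "factors_uniquely \<Lambda> G i H"
  unfolding factors_uniquely_def
proof (intro allI impI)
  fix F assume F: "is_functor \<Lambda> H F"
  let ?P = "category.Pi_cat \<Lambda>" and ?j = "category.Pi_incl \<Lambda>"
  have G: "groupoid G" and i: "is_functor \<Lambda> G i" and uG: "factors_uniquely \<Lambda> G i G"
    and uP: "factors_uniquely \<Lambda> G i ?P"
    using fg category.Pi_groupoid[OF cat] by (auto simp: fundamental_groupoid_def)
  have Gc: "category G" using G by (simp add: groupoid_def)
  have Pc: "category ?P" using category.Pi_groupoid[OF cat] by (simp add: groupoid_def)
  have j: "is_functor \<Lambda> ?P ?j" by (rule category.Pi_incl_functor[OF cat])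
  note P = Pi_factors_uniquely[OF cat]
  obtain f where f: "is_functor G ?P f" "\<And>x. x \<in> mor \<Lambda> \<Longrightarrow> f (i x) = ?j x"
    using factors_uniquely_exists[OF uP j] by blast
  obtain h where h: "is_functor ?P G h" "\<And>x. x \<in> mor \<Lambda> \<Longrightarrow> h (?j x) = i x"
    using factors_uniquely_exists[OF P[OF G] i] by blast
  obtain F0 where F0: "is_functor ?P H F0" "\<And>x. x \<in> mor \<Lambda> \<Longrightarrow> F0 (?j x) = F x"
    using factors_uniquely_exists[OF P[OF H] F] by blast
  have hf: "(h \<circ> f) g = id g" if "g \<in> mor G" for g
    by (rule factors_uniquely_eq[OF uG Gc i is_functor_comp[OF f(1) h(1)] _ _ that])
      (use f h in \<open>auto simp: is_functor_def\<close>)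
  let ?K = "restrict (F0 \<circ> f) (mor G)"
  show "\<exists>!F'. F' \<in> extensional (mor G) \<and> is_functor G H F' \<and> (\<forall>x\<in>mor \<Lambda>. F' (i x) = F x)"
  proof (rule ex1I[of _ ?K])
    have "is_functor G H ?K"
      by (rule is_functor_cong[OF is_functor_comp[OF f(1) F0(1)] Gc]) simp
    moreover have "i x \<in> mor G" if "x \<in> mor \<Lambda>" for x using i that by (simp add: is_functor_def)
    ultimately show "?K \<in> extensional (mor G) \<and> is_functor G H ?K \<and> (\<forall>x\<in>mor \<Lambda>. ?K (i x) = F x)"
      using f F0 by simp
    fix K assume K: "K \<in> extensional (mor G) \<and> is_functor G H K \<and> (\<forall>x\<in>mor \<Lambda>. K (i x) = F x)"
    then have KH: "is_functor G H K" by blast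
    have e: "(K \<circ> h) A = F0 A" if "A \<in> mor ?P" for A
      by (rule factors_uniquely_eq[OF P[OF H] Pc j is_functor_comp[OF h(1) KH] F0(1) _ that])
        (use K h F0 in simp)
    show "K = ?K"
    proof (rule extensionalityI[of _ "mor G"])
      fix g assume g: "g \<in> mor G"
      then have "f g \<in> mor ?P" using f by (simp add: is_functor_def)
      then show "K g = ?K g" using e[of "f g"] hf[OF g] g by simp
    qed (use K in auto)
  qed
qed

end

(* Whether i is injective can be tested on the word model of the fundamental groupoid.  A covering
   is determined on arrows by the image together with an endpoint, and it lifts each generating
   relation between words to a relation of the same kind upstairs; hence equal images in \<Pi>(\<Lambda>)
   of two arrows of \<Lambda> lift to equal images in \<Pi>(\<Sigma>).  Conversely, \<Pi>(p) and the fact that i is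
   always injective on objects reduce injectivity upstairs to injectivity downstairs. *)
theory Submission
  imports Defs
begin

section \<open>Passage to the word model of the fundamental groupoid\<close>

text \<open>Universal properties give functors both ways between \<open>G\<close> and
  \<open>Pi_cat\<close>, each compatible with the two inclusions; an equality of images on either
  side is carried to the other.\<close>

lemma fundamental_groupoid_incl_eq_iff:
  assumes "category C" "fundamental_groupoid C G i" "x \<in> mor C" "y \<in> mor C"
  shows "i x = i y \<longleftrightarrow> category.Pi_incl C x = category.Pi_incl C y"
proof -
  have G: "groupoid G" and i: "is_functor C G i"
    and u: "factors_uniquely C G i (category.Pi_cat C)"
    using assms(2) category.Pi_groupoid[OF assms(1)] by (auto simp: fundamental_groupoid_def)
  show ?thesis
  proof
    assume eq: "i x = i y"
    show "category.Pi_incl C x = category.Pi_incl C y"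
      using factors_uniquely_exists[OF u category.Pi_incl_functor[OF assms(1)]] assms(3,4) eq
      by metis
  next
    assume eq: "category.Pi_incl C x = category.Pi_incl C y"
    show "i x = i y"
      using factors_uniquely_exists[OF Pi_factors_uniquely[OF assms(1) G] i] assms(3,4) eq
      by metis
  qed
qed

lemma (in category) Pi_incl_eq_iff:
  "x \<in> mor C \<Longrightarrow> Pi_incl x = Pi_incl y \<longleftrightarrow> weq [(x, True)] [(y, True)]"
  by (simp add: Pi_incl_def cls_eq)

section \<open>Coverings and unique lifting of arrows\<close>

locale category_covering = S: category S + L: category L
  for S :: "('b, 'm) cat_scheme" and L :: "('a, 'n) cat_scheme" +
  fixes p :: "'b \<Rightarrow> 'a"
  assumes functor_p: "is_functor S L p"
    and surj_p: "p ` mor S = mor L"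
    and src_bij: "v \<in> obj S \<Longrightarrow>
      bij_betw p {x \<in> mor S. src S x = v} {y \<in> mor L. src L y = p v}"
    and tgt_bij: "v \<in> obj S \<Longrightarrow>
      bij_betw p {x \<in> mor S. tgt S x = v} {y \<in> mor L. tgt L y = p v}"
begin

lemma p_simps [simp]:
  "x \<in> mor S \<Longrightarrow> p x \<in> mor L"
  "x \<in> mor S \<Longrightarrow> src L (p x) = p (src S x)"
  "x \<in> mor S \<Longrightarrow> tgt L (p x) = p (tgt S x)"
  "\<lbrakk>x \<in> mor S; y \<in> mor S; src S x = tgt S y\<rbrakk> \<Longrightarrow> p (x \<odot>\<^bsub>S\<^esub> y) = p x \<odot>\<^bsub>L\<^esub> p y"
  using functor_p unfolding is_functor_def by metis+

lemma p_eq_src: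
  assumes "x \<in> mor S" "y \<in> mor S" "src S x = src S y" "p x = p y"
  shows "x = y"
proof -
  have "src S y \<in> obj S" using assms by (auto simp: obj_def)
  from bij_betw_imp_inj_on[OF src_bij[OF this]] show ?thesis
    using assms by (auto dest: inj_onD)
qed

lemma p_eq_tgt:
  assumes "x \<in> mor S" "y \<in> mor S" "tgt S x = tgt S y" "p x = p y"
  shows "x = y"
proof -
  have "tgt S y \<in> obj S" using assms by (auto simp: obj_def)
  from bij_betw_imp_inj_on[OF tgt_bij[OF this]] show ?thesis
    using assms by (auto dest: inj_onD)
qed

lemma lift_src:
  assumes "v \<in> obj S" "y \<in> mor L" "src L y = p v"
  obtains x where "x \<in> mor S" "src S x = v" "p x = y"
proof -
  have "y \<in> p ` {x \<in> mor S. src S x = v}"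
    unfolding bij_betw_imp_surj_on[OF src_bij[OF assms(1)]] using assms(2,3) by simp
  then show thesis using that by auto
qed

lemma lift_tgt:
  assumes "v \<in> obj S" "y \<in> mor L" "tgt L y = p v"
  obtains x where "x \<in> mor S" "tgt S x = v" "p x = y"
proof -
  have "y \<in> p ` {x \<in> mor S. tgt S x = v}"
    unfolding bij_betw_imp_surj_on[OF tgt_bij[OF assms(1)]] using assms(2,3) by simp
  then show thesis using that by auto
qed

text \<open>The arrows \<open>t\<close> and \<open>src S t\<close> share their source, and both lie
  over the identity \<open>p t\<close>; unique lifting makes them equal. This handles letters lying
  over formal units.\<close>

lemma lift_obj:
  assumes "t \<in> mor S" "p t \<in> obj L"
  shows "t \<in> obj S"
proof -
  have "src S t = t"
    by (rule p_eq_src) (use assms L.obj_mor[OF assms(2)] in auto)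
  then show ?thesis using assms by (simp add: obj_def)
qed

section \<open>Lifting relations between signed words\<close>

abbreviation map_word :: "('b \<times> bool) list \<Rightarrow> ('a \<times> bool) list" where
  "map_word \<equiv> map (map_prod p id)"

text \<open>Every lift of \<open>u\<close> is considered, not just one, since a subword of a lifted
  word is a lift over which there is no control. As \<open>S.weq\<close> preserves endpoints, the
  lift \<open>w'\<close> fits wherever \<open>u'\<close> did.\<close>

definition lifts_to :: "('a \<times> bool) list \<Rightarrow> ('a \<times> bool) list \<Rightarrow> bool" where
  "lifts_to u w \<longleftrightarrow> (\<forall>u'. S.word u' \<and> map_word u' = u \<longrightarrow> (\<exists>w'. map_word w' = w \<and> S.weq u' w'))"

lemma lifts_toI:
  "(\<And>u'. S.word u' \<Longrightarrow> map_word u' = u \<Longrightarrow> \<exists>w'. map_word w' = w \<and> S.weq u' w') \<Longrightarrow> lifts_to u w"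
  by (simp add: lifts_to_def)

lemma lifts_toE:
  assumes "lifts_to u w" "S.word u'" "map_word u' = u"
  obtains w' where "map_word w' = w" "S.weq u' w'"
proof -
  have "\<exists>w'. map_word w' = w \<and> S.weq u' w'" using assms by (simp add: lifts_to_def)
  then show thesis using that by (elim exE conjE)
qed

lemma lifts_to_trans:
  assumes "lifts_to u v" "lifts_to v w"
  shows "lifts_to u w"
proof (rule lifts_toI)
  fix u' assume "S.word u'" "map_word u' = u"
  then obtain v' where v': "map_word v' = v" "S.weq u' v'"
    using assms(1) by (auto simp: lifts_to_def)
  then obtain w' where "map_word w' = w" "S.weq v' w'"
    using assms(2) S.weq_word[OF v'(2)] by (auto simp: lifts_to_def)
  then show "\<exists>w'. map_word w' = w \<and> S.weq u' w'" using S.weq_trans[OF v'(2)] by blast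
qed

text \<open>A lift of \<open>u @ v\<close> splits into lifts of \<open>u\<close> and
  \<open>v\<close>, which are rewritten separately and glued by \<open>S.weq_cong\<close>.
  Nonemptiness makes both pieces words, as the empty list is not one.\<close>

lemma lifts_to_append:
  assumes "lifts_to u u1" "lifts_to v v1" "u \<noteq> []" "v \<noteq> []"
  shows "lifts_to (u @ v) (u1 @ v1)"
proof (rule lifts_toI)
  fix w assume w: "S.word w" "map_word w = u @ v"
  then obtain a b where ab: "w = a @ b" "map_word a = u" "map_word b = v"
    by (auto simp: map_eq_append_conv)
  then have "a \<noteq> []" "b \<noteq> []" using assms by auto
  then have wab: "S.word a" "S.word b" "S.wsrc a = S.wtgt b"
    using w ab S.word_append by auto
  have "\<exists>a1. map_word a1 = u1 \<and> S.weq a a1" "\<exists>b1. map_word b1 = v1 \<and> S.weq b b1"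
    using assms(1,2) wab(1,2) ab(2,3) by (simp_all add: lifts_to_def)
  then obtain a1 b1 where "map_word a1 = u1" "S.weq a a1" "map_word b1 = v1" "S.weq b b1"
    by blast
  then have "map_word (a1 @ b1) = u1 @ v1" "S.weq w (a1 @ b1)"
    using S.weq_cong[of a a1 b b1] wab(3) ab(1) by simp_all
  then show "\<exists>w'. map_word w' = u1 @ v1 \<and> S.weq w w'" by blast
qed

lemma map_word_eq_single: "map_word u = [(x, b)] \<longleftrightarrow> (\<exists>x'. u = [(x', b)] \<and> p x' = x)"
  by (auto simp: map_eq_Cons_conv)

lemma map_word_eq_pair:
  "map_word u = [(x, b), (y, c)] \<longleftrightarrow> (\<exists>x' y'. u = [(x', b), (y', c)] \<and> p x' = x \<and> p y' = y)"
  by (auto simp: map_eq_Cons_conv)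

lemma lifts_to_cmp:
  assumes "x \<in> mor L" "y \<in> mor L" "src L x = tgt L y"
  shows "lifts_to [(x, True), (y, True)] [(x \<odot>\<^bsub>L\<^esub> y, True)]"
    and "lifts_to [(x \<odot>\<^bsub>L\<^esub> y, True)] [(x, True), (y, True)]"
proof -
  show "lifts_to [(x, True), (y, True)] [(x \<odot>\<^bsub>L\<^esub> y, True)]"
  proof (rule lifts_toI)
    fix u assume "S.word u" "map_word u = [(x, True), (y, True)]"
    then obtain x' y' where u: "u = [(x', True), (y', True)]" "x' \<in> mor S" "y' \<in> mor S"
      "src S x' = tgt S y'" "p x' = x" "p y' = y" by (auto simp: map_word_eq_pair)
    then show "\<exists>w. map_word w = [(x \<odot>\<^bsub>L\<^esub> y, True)] \<and> S.weq u w"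
      using S.weq_cmp[of x' y'] by (intro exI[of _ "[(x' \<odot>\<^bsub>S\<^esub> y', True)]"]) simp
  qed
  show "lifts_to [(x \<odot>\<^bsub>L\<^esub> y, True)] [(x, True), (y, True)]"
  proof (rule lifts_toI)
    fix u assume "S.word u" "map_word u = [(x \<odot>\<^bsub>L\<^esub> y, True)]"
    then obtain z where z: "u = [(z, True)]" "z \<in> mor S" "p z = x \<odot>\<^bsub>L\<^esub> y"
      by (auto simp: map_word_eq_single)
    \<comment> \<open>A factorisation of \<open>z\<close> over the given one is built from its
      source: lift \<open>y\<close> there, then lift \<open>x\<close> at the target of that
      lift.\<close>
    have "src L y = p (src S z)" using z assms L.src_cmp[of x y] p_simps(2)[of z] by simp
    then obtain y' where y': "y' \<in> mor S" "src S y' = src S z" "p y' = y"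
      using lift_src[of "src S z" y] z assms by (auto simp: obj_def)
    have "src L x = p (tgt S y')" using y' assms p_simps(3)[of y'] by simp
    then obtain x' where x': "x' \<in> mor S" "src S x' = tgt S y'" "p x' = x"
      using lift_src[of "tgt S y'" x] y' assms by (auto simp: obj_def)
    \<comment> \<open>Both arrows start at \<open>src S z\<close> and lie over the same
      composite.\<close>
    have "z = x' \<odot>\<^bsub>S\<^esub> y'" by (rule p_eq_src) (use x' y' z in auto)
    then have "S.weq u [(x', True), (y', True)]" using x' y' z S.weq_sym[OF S.weq_cmp] by simp
    then show "\<exists>w. map_word w = [(x, True), (y, True)] \<and> S.weq u w"
      using x' y' by (intro exI[of _ "[(x', True), (y', True)]"]) simp
  qed
qed

lemma lifts_to_inv_r:
  assumes "x \<in> mor L"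
  shows "lifts_to [(x, True), (x, False)] [(tgt L x, True)]"
    and "lifts_to [(tgt L x, True)] [(x, True), (x, False)]"
proof -
  show "lifts_to [(x, True), (x, False)] [(tgt L x, True)]"
  proof (rule lifts_toI)
    fix u assume "S.word u" "map_word u = [(x, True), (x, False)]"
    then obtain a b where u: "u = [(a, True), (b, False)]" "a \<in> mor S" "b \<in> mor S"
      "src S a = src S b" "p a = x" "p b = x" by (auto simp: map_word_eq_pair)
    \<comment> \<open>Two letters over \<open>x\<close> could differ a priori; adjacency with
      opposite signs gives them a common source, and unique lifting identifies them.\<close>
    then have "a = b" by (metis p_eq_src)
    then show "\<exists>w. map_word w = [(tgt L x, True)] \<and> S.weq u w"
      using u S.weq_inv_r[of a] by (intro exI[of _ "[(tgt S a, True)]"]) auto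
  qed
  show "lifts_to [(tgt L x, True)] [(x, True), (x, False)]"
  proof (rule lifts_toI)
    fix u assume "S.word u" "map_word u = [(tgt L x, True)]"
    then obtain t where t: "u = [(t, True)]" "t \<in> mor S" "p t = tgt L x"
      by (auto simp: map_word_eq_single)
    \<comment> \<open>Being a word only makes \<open>t\<close> an arrow; it must be an identity to
      serve as the endpoint at which \<open>x\<close> is lifted.\<close>
    have "t \<in> obj S" using t assms by (intro lift_obj) (auto simp: obj_def)
    then obtain x' where "x' \<in> mor S" "tgt S x' = t" "p x' = x"
      using lift_tgt[of t x] t assms by auto
    then show "\<exists>w. map_word w = [(x, True), (x, False)] \<and> S.weq u w"
      using t S.weq_sym[OF S.weq_inv_r, of x']
      by (intro exI[of _ "[(x', True), (x', False)]"]) simp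
  qed
qed

text \<open>Mirror image of \<open>lifts_to_inv_r\<close>: the letters now meet at their targets, so
  uniqueness comes from the bijection on arrows with fixed target, and \<open>x\<close> is lifted
  from its source.\<close>

lemma lifts_to_inv_l:
  assumes "x \<in> mor L"
  shows "lifts_to [(x, False), (x, True)] [(src L x, True)]"
    and "lifts_to [(src L x, True)] [(x, False), (x, True)]"
proof -
  show "lifts_to [(x, False), (x, True)] [(src L x, True)]"
  proof (rule lifts_toI)
    fix u assume "S.word u" "map_word u = [(x, False), (x, True)]"
    then obtain a b where u: "u = [(a, False), (b, True)]" "a \<in> mor S" "b \<in> mor S"
      "tgt S a = tgt S b" "p a = x" "p b = x" by (auto simp: map_word_eq_pair)
    then have "a = b" by (metis p_eq_tgt)
    then show "\<exists>w. map_word w = [(src L x, True)] \<and> S.weq u w"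
      using u S.weq_inv_l[of a] by (intro exI[of _ "[(src S a, True)]"]) auto
  qed
  show "lifts_to [(src L x, True)] [(x, False), (x, True)]"
  proof (rule lifts_toI)
    fix u assume "S.word u" "map_word u = [(src L x, True)]"
    then obtain t where t: "u = [(t, True)]" "t \<in> mor S" "p t = src L x"
      by (auto simp: map_word_eq_single)
    have "t \<in> obj S" using t assms by (intro lift_obj) (auto simp: obj_def)
    then obtain x' where "x' \<in> mor S" "src S x' = t" "p x' = x"
      using lift_src[of t x] t assms by auto
    then show "\<exists>w. map_word w = [(x, False), (x, True)] \<and> S.weq u w"
      using t S.weq_sym[OF S.weq_inv_l, of x']
      by (intro exI[of _ "[(x', False), (x', True)]"]) simp
  qed
qed

lemma lifts_to_unit_l:
  assumes "x \<in> mor L"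
  shows "lifts_to [(src L x, True), (x, False)] [(x, False)]"
    and "lifts_to [(x, False)] [(src L x, True), (x, False)]"
proof -
  show "lifts_to [(src L x, True), (x, False)] [(x, False)]"
  proof (rule lifts_toI)
    fix u assume w: "S.word u" and "map_word u = [(src L x, True), (x, False)]"
    then obtain t a where u: "u = [(t, True), (a, False)]" "p t = src L x" "p a = x"
      unfolding map_word_eq_pair by blast
    have ta: "t \<in> mor S" "a \<in> mor S" "src S t = src S a" using w u(1) by auto
    \<comment> \<open>Once \<open>t\<close> is an identity, composability with the inverse of
      \<open>a\<close> leaves only \<open>src S a\<close>, and the upstairs unit relation
      applies.\<close>
    have "t \<in> obj S" using lift_obj[OF ta(1)] u(2) assms by (simp add: obj_def)
    then have "t = src S a" using ta(3) S.obj_mor by simp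
    then have "S.weq u [(a, False)]" using u(1) S.weq_unit_l[OF ta(2)] by simp
    then show "\<exists>w. map_word w = [(x, False)] \<and> S.weq u w"
      using u(3) by (intro exI[of _ "[(a, False)]"]) simp
  qed
  show "lifts_to [(x, False)] [(src L x, True), (x, False)]"
  proof (rule lifts_toI)
    fix u assume "S.word u" "map_word u = [(x, False)]"
    then obtain a where a: "u = [(a, False)]" "a \<in> mor S" "p a = x"
      by (auto simp: map_word_eq_single)
    have "p (src S a) = src L x" using a p_simps(2)[of a] by metis
    then show "\<exists>w. map_word w = [(src L x, True), (x, False)] \<and> S.weq u w"
      using a S.weq_sym[OF S.weq_unit_l[OF a(2)]]
      by (intro exI[of _ "[(src S a, True), (a, False)]"]) simp
  qed
qed

lemma lifts_to_unit_r:
  assumes "x \<in> mor L"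
  shows "lifts_to [(x, False), (tgt L x, True)] [(x, False)]"
    and "lifts_to [(x, False)] [(x, False), (tgt L x, True)]"
proof -
  show "lifts_to [(x, False), (tgt L x, True)] [(x, False)]"
  proof (rule lifts_toI)
    fix u assume w: "S.word u" and "map_word u = [(x, False), (tgt L x, True)]"
    then obtain a t where u: "u = [(a, False), (t, True)]" "p t = tgt L x" "p a = x"
      unfolding map_word_eq_pair by blast
    have ta: "t \<in> mor S" "a \<in> mor S" "tgt S a = tgt S t" using w u(1) by auto
    have "t \<in> obj S" using lift_obj[OF ta(1)] u(2) assms by (simp add: obj_def)
    then have "t = tgt S a" using ta(3) S.obj_mor by simp
    then have "S.weq u [(a, False)]" using u(1) S.weq_unit_r[OF ta(2)] by simp
    then show "\<exists>w. map_word w = [(x, False)] \<and> S.weq u w"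
      using u(3) by (intro exI[of _ "[(a, False)]"]) simp
  qed
  show "lifts_to [(x, False)] [(x, False), (tgt L x, True)]"
  proof (rule lifts_toI)
    fix u assume "S.word u" "map_word u = [(x, False)]"
    then obtain a where a: "u = [(a, False)]" "a \<in> mor S" "p a = x"
      by (auto simp: map_word_eq_single)
    have "p (tgt S a) = tgt L x" using a p_simps(3)[of a] by metis
    then show "\<exists>w. map_word w = [(x, False), (tgt L x, True)] \<and> S.weq u w"
      using a S.weq_sym[OF S.weq_unit_r[OF a(2)]]
      by (intro exI[of _ "[(a, False), (tgt S a, True)]"]) simp
  qed
qed

(* Carrying both directions through the induction makes symmetry trivial. *)
lemma weq_lifts_to: "L.weq u w \<Longrightarrow> lifts_to u w \<and> lifts_to w u"
proof (induction rule: L.weq.induct)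
  case (weq_refl w)
  then show ?case using S.weq_refl by (auto simp: lifts_to_def)
next
  case (weq_trans u v w)
  then show ?case using lifts_to_trans by blast
next
  case (weq_cong u u' v v')
  then have "u \<noteq> []" "u' \<noteq> []" "v \<noteq> []" "v' \<noteq> []"
    using L.weq_word L.word_ne by blast+
  then show ?case using weq_cong lifts_to_append by blast
qed (use lifts_to_cmp lifts_to_inv_r lifts_to_inv_l lifts_to_unit_l lifts_to_unit_r in auto)

section \<open>Transfer of injectivity between base and cover\<close>

lemma inj_on_Pi_incl_base:
  assumes "inj_on S.Pi_incl (mor S)"
  shows "inj_on L.Pi_incl (mor L)"
proof (rule inj_onI)
  fix x y assume x: "x \<in> mor L" and eq: "L.Pi_incl x = L.Pi_incl y"
  have "L.weq [(x, True)] [(y, True)]" using L.Pi_incl_eq_iff[OF x] eq by blast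
  from weq_lifts_to[OF this] have "lifts_to [(x, True)] [(y, True)]" ..
  \<comment> \<open>\<open>lifts_to\<close> is vacuous for a word without lifts; surjectivity of
    \<open>p\<close> supplies one to start from.\<close>
  moreover obtain x' where x': "x' \<in> mor S" "p x' = x"
    using x unfolding surj_p[symmetric] by auto
  then have "S.word [(x', True)]" "map_word [(x', True)] = [(x, True)]" by simp_all
  ultimately obtain w where w: "map_word w = [(y, True)]" "S.weq [(x', True)] w"
    by (rule lifts_toE)
  \<comment> \<open>\<open>map_word\<close> keeps length and signs, so the lifted word is again one
    positive letter and its class is a value of \<open>S.Pi_incl\<close>.\<close>
  from w(1) obtain y' where "w = [(y', True)]" "p y' = y"
    unfolding map_word_eq_single by blast
  with w(2) have y': "p y' = y" "S.weq [(x', True)] [(y', True)]" by simp_all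
  have "y' \<in> mor S" using S.weq_word[OF y'(2)] by simp
  moreover have "S.Pi_incl x' = S.Pi_incl y'"
    using S.Pi_incl_eq_iff[OF x'(1)] y'(2) by blast
  ultimately have "x' = y'" using inj_onD[OF assms] x'(1) by blast
  then show "x = y" using x' y' by simp
qed

lemma inj_on_Pi_incl_cover:
  assumes "inj_on L.Pi_incl (mor L)"
  shows "inj_on S.Pi_incl (mor S)"
proof (rule inj_onI)
  fix x y assume x: "x \<in> mor S" and y: "y \<in> mor S" and eq: "S.Pi_incl x = S.Pi_incl y"
  \<comment> \<open>The functor provided by the universal property is the homomorphism of
    fundamental groupoids induced by \<open>p\<close>.\<close>
  have "(L.Pi_incl \<circ> p) x = (L.Pi_incl \<circ> p) y"
    using factors_uniquely_exists[OF Pi_factors_uniquely[OF S.category_axioms L.Pi_groupoid]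
        is_functor_comp[OF functor_p L.Pi_incl_functor]] x y eq by metis
  then have "L.Pi_incl (p x) = L.Pi_incl (p y)" by simp
  then have "p x = p y" using assms x y by (auto dest: inj_onD)
  \<comment> \<open>Equivalent words have equal endpoints; this is what \<open>p x = p y\<close>
    lacks for unique lifting.\<close>
  moreover have "src S x = src S y"
    using eq x S.weq_word[of "[(x, True)]" "[(y, True)]"] by (simp add: S.Pi_incl_eq_iff)
  ultimately show "x = y" using x y p_eq_src by blast
qed

end

theorem proposition3p13:
  fixes \<Lambda> :: "'a kgraph" and \<Sigma> :: "'b kgraph" and k :: nat and p :: "'b \<Rightarrow> 'a"
    and Pi_\<Lambda> :: "'g cat" and i_\<Lambda> :: "'a \<Rightarrow> 'g"
    and Pi_\<Sigma> :: "'h cat" and i_\<Sigma> :: "'b \<Rightarrow> 'h"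
  assumes "k_graph k \<Lambda>" and "connected_cat \<Lambda>"
    and "k_graph k \<Sigma>" and "connected_cat \<Sigma>"
    and "covering \<Sigma> \<Lambda> p"
    and "fundamental_groupoid \<Lambda> Pi_\<Lambda> i_\<Lambda>"
    and "fundamental_groupoid \<Sigma> Pi_\<Sigma> i_\<Sigma>"
  shows "inj_on i_\<Lambda> (mor \<Lambda>) \<longleftrightarrow> inj_on i_\<Sigma> (mor \<Sigma>)"
proof -
  have L: "category \<Lambda>" and S: "category \<Sigma>" using assms(1,3) by (simp_all add: k_graph_def)
  interpret category_covering \<Sigma> \<Lambda> p
    using L S assms(5)
    by (auto simp: category_covering_def category_covering_axioms_def covering_def)
  have "inj_on i_\<Lambda> (mor \<Lambda>) \<longleftrightarrow> inj_on L.Pi_incl (mor \<Lambda>)"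
    using fundamental_groupoid_incl_eq_iff[OF L assms(6)] by (simp add: inj_on_def)
  moreover have "inj_on i_\<Sigma> (mor \<Sigma>) \<longleftrightarrow> inj_on S.Pi_incl (mor \<Sigma>)"
    using fundamental_groupoid_incl_eq_iff[OF S assms(7)] by (simp add: inj_on_def)
  ultimately show ?thesis using inj_on_Pi_incl_base inj_on_Pi_incl_cover by blast
qed

end
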